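(* Let $\Omega$ be a tiling space of tilings of $\mathbb R^d$. If $f\in C[\Omega,\mathbb C]$ is a continuous eigenfunction of the tiling dynamical system $(\Omega,\mathbb R^d)$ with eigenvalue $\alpha\in\mathbb R^d$, and $\Omega$ has a fracture in the direction of $x\in\mathbb R^d$, then $\alpha\cdot x$ is an integer.
   Context: Prototiles. Let $\mathcal S$ be a set of subsets of $\mathbb R^d$, each of which is a topological disk containing the origin in its interior, and assume $\mathcal S$ is a compact metric space under the Hausdorff metric $d_H$. Let $(\mathcal L,d_L)$ be another compact metric space (the label set) and let $sp:\mathcal L\to\mathcal S$ be a continuous surjection. A prototile is a pair $p=(S,l)$ with $S\in\mathcal S$, $l\in\mathcal L$ and $S=sp(l)$; the prototile set $\mathcal P$ is the set of all such pairs. Tiles. For $p=(S,l)\in\mathcal P$ and $x\in\mathbb R^d$, the pair $t=p-x=(S-x,l)$ is a ($\mathcal P$-)tile, with support $\mathrm{supp}(t)=S-x$ and label $\mathrm{label}(t)=l$. Translating a tile translates its support and keeps its label. Patches and tilings. A patch is a finite union of $\mathcal P$-tiles whose supports cover a connected region and intersect only on their boundaries; $\mathrm{supp}(P)$ is the union of the supports of the tiles of $P$. A tiling $\mathbf T$ is an infinite union of $\mathcal P$-tiles whose supports cover $\mathbb R^d$ and whose pairwise intersections contain only boundary points. For $x\in\mathbb R^d$, $\mathbf T-x$ is the tiling obtained by translating every tile $t$ of $\mathbf T$ to $t-x$. Metrics. For tiles, $d(t_1,t_2)=\max\big(d_H(\mathrm{supp}(t_1),\mathrm{supp}(t_2)),\,d_L(\mathrm{label}(t_1),\mathrm{label}(t_2))\big)$.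 For patches $P_1,P_2$ whose tiles are in one-to-one correspondence, $d(P_1,P_2)=\min_g\max_{t\in P_1} d(t,g(t))$, where $g$ ranges over all bijections from the tiles of $P_1$ to the tiles of $P_2$. For tilings, $d(\mathbf T_1,\mathbf T_2)$ is the infimum of all $\epsilon>0$ for which there are patches $P_1\subset\mathbf T_1$ and $P_2\subset\mathbf T_2$ with $B_{1/\epsilon}(0)\subset\mathrm{supp}(P_i)$ for $i=1,2$ and $d(P_1,P_2)<\epsilon$; if no such $\epsilon$ exists or the infimum is greater than $1$, then $d(\mathbf T_1,\mathbf T_2)=1$. Tiling space. A tiling space $\Omega$ is a set of tilings of $\mathbb R^d$ that is invariant under translation and closed in the topology given by the tiling metric $d$. The tiling dynamical system $(\Omega,\mathbb R^d)$ is $\Omega$ with the action of $\mathbb R^d$ by translation. Fracture. $\Omega$ has a fracture in the direction of $x\in\mathbb R^d$ if there exist some $y\in\mathbb R^d$ and two tilings $\mathbf T,\mathbf T'\in\Omega$ such that $\lim_{t\to\infty}d(\mathbf T-ty,\mathbf T'-ty)=0$ and $\lim_{t\to-\infty}d(\mathbf T-ty,\mathbf T'-x-ty)=0$. Eigenfunction. $(\Omega,\mathbb R^d)$ has an eigenfunction $f:\Omega\to\mathbb C$ with eigenvalue $\alpha\in\mathbb R^d$ if for any $\mathbf T\in\Omega$ and $y\in\mathbb R^d$, $f(\mathbf T-y)=\exp(2\pi i\,\alpha\cdot y)f(\mathbf T)$.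
   Formalization: The formal theorem additionally assumes that the tiling space Ω is compact in the tiling metric topology and that the eigenfunction f vanishes nowhere on Ω; without these the claim fails (f = 0, or a non-compact Ω built from interlocking comb-shaped tiles). *)

theory Defs
  imports "HOL-Analysis.Analysis"
begin

subsection \<open>Hausdorff distance\<close>

text \<open>The value is only meaningful for nonempty bounded sets; the default \<open>0\<close> keeps the function
  nonnegative and symmetric everywhere, as the locale \<open>Metric_space\<close> demands.\<close>

definition hausdorff_dist :: "'a::metric_space set \<Rightarrow> 'a set \<Rightarrow> real" where
  "hausdorff_dist A B =
     (if A \<noteq> {} \<and> B \<noteq> {} \<and> bounded A \<and> bounded B
      then max (SUP a\<in>A. infdist a B) (SUP b\<in>B. infdist b A) else 0)"

lemma infdist_bdd_above:
  fixes A B :: "'a::metric_space set"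
  assumes "bounded A"
  shows "bdd_above ((\<lambda>a. infdist a B) ` A)"
proof (cases "A = {}")
  case False
  then obtain a where a: "a \<in> A" by auto
  obtain e where e: "\<And>y. y \<in> A \<Longrightarrow> dist a y \<le> e"
    using assms bounded_any_center[of A a] by auto
  have "infdist y B \<le> infdist a B + e" if "y \<in> A" for y
    using infdist_triangle[of y B a] e[OF that] by (simp add: dist_commute)
  then show ?thesis by (auto intro!: bdd_aboveI)
qed auto

lemma hausdorff_dist_le_iff:
  assumes "A \<noteq> {}" "B \<noteq> {}" "bounded A" "bounded B"
  shows "hausdorff_dist A B \<le> r \<longleftrightarrow> (\<forall>a\<in>A. infdist a B \<le> r) \<and> (\<forall>b\<in>B. infdist b A \<le> r)"
  using assms by (simp add: hausdorff_dist_def cSUP_le_iff infdist_bdd_above)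

lemma hausdorff_dist_nonneg: "0 \<le> hausdorff_dist A B"
proof (cases "A \<noteq> {} \<and> B \<noteq> {} \<and> bounded A \<and> bounded B")
  case True
  then obtain a where "a \<in> A" by auto
  then show ?thesis
    using hausdorff_dist_le_iff[of A B "hausdorff_dist A B"] True infdist_nonneg[of a B]
    by fastforce
qed (auto simp: hausdorff_dist_def)

lemma hausdorff_dist_commute: "hausdorff_dist A B = hausdorff_dist B A"
  by (auto simp: hausdorff_dist_def max.commute)

lemma Metric_space_hausdorff_dist:
  fixes \<S> :: "'a::heine_borel set set"
  assumes "\<And>A. A \<in> \<S> \<Longrightarrow> A \<noteq> {} \<and> compact A"
  shows "Metric_space \<S> hausdorff_dist"
proof
  have ne: "A \<noteq> {}" and bd: "bounded A" and cl: "closed A" if "A \<in> \<S>" for A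
    using assms[OF that] compact_imp_bounded compact_imp_closed by blast+
  have upper: "infdist a B \<le> hausdorff_dist A B" if "A \<in> \<S>" "B \<in> \<S>" "a \<in> A" for a A B
    using hausdorff_dist_le_iff[OF ne[OF that(1)] ne[OF that(2)] bd[OF that(1)] bd[OF that(2)],
        of "hausdorff_dist A B"] that(3) by simp
  fix A B C :: "'a set"
  show "0 \<le> hausdorff_dist A B" by (rule hausdorff_dist_nonneg)
  show "hausdorff_dist A B = hausdorff_dist B A" by (rule hausdorff_dist_commute)
  show "hausdorff_dist A B = 0 \<longleftrightarrow> A = B" if AB: "A \<in> \<S>" "B \<in> \<S>"
  proof
    have sub: "X \<subseteq> Y" if XY: "X \<in> \<S>" "Y \<in> \<S>" and 0: "hausdorff_dist X Y = 0" for X Y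
    proof
      fix a assume "a \<in> X"
      then have "infdist a Y = 0"
        using upper[OF XY] infdist_nonneg[of a Y] 0 by fastforce
      then show "a \<in> Y"
        using in_closed_iff_infdist_zero[OF cl ne] XY(2) by blast
    qed
    assume "hausdorff_dist A B = 0"
    then show "A = B"
      using sub[OF AB] sub[OF AB(2,1)] hausdorff_dist_commute[of A B] by simp
  next
    assume "A = B"
    then have "hausdorff_dist A B \<le> 0"
      using hausdorff_dist_le_iff[OF ne ne bd bd, OF AB AB, of 0] by simp
    then show "hausdorff_dist A B = 0"
      using hausdorff_dist_nonneg[of A B] by linarith
  qed
  show "hausdorff_dist A C \<le> hausdorff_dist A B + hausdorff_dist B C"
    if ABC: "A \<in> \<S>" "B \<in> \<S>" "C \<in> \<S>"
  proof -
    have le: "infdist x Z \<le> hausdorff_dist X Y + hausdorff_dist Y Z"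
      if XYZ: "X \<in> \<S>" "Y \<in> \<S>" "Z \<in> \<S>" and x: "x \<in> X" for x X Y Z
    proof -
      obtain y where y: "y \<in> Y" "infdist x Y = dist x y"
        using infdist_attains_inf[OF cl ne, OF XYZ(2) XYZ(2)] by metis
      then show ?thesis
        using infdist_triangle[of x Z y] upper[OF XYZ(1,2) x] upper[OF XYZ(2,3) y(1)] by linarith
    qed
    have "infdist c A \<le> hausdorff_dist A B + hausdorff_dist B C" if "c \<in> C" for c
      using le[OF ABC(3,2,1) that] hausdorff_dist_commute[of A B] hausdorff_dist_commute[of B C]
      by linarith
    then show ?thesis
      using hausdorff_dist_le_iff[OF ne ne bd bd, OF ABC(1,3) ABC(1,3)] le[OF ABC] by blast
  qed
qed

subsection \<open>Prototiles and tiles\<close>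

text \<open>A tile is a pair of its support and its label; the space is \<open>real ^ 'd\<close>.\<close>

type_synonym ('d, 'l) tile = "(real ^ 'd) set \<times> 'l"

text \<open>Topological disks are homeomorphic images of the closed unit ball: the Hausdorff distance
  is a metric only on closed sets.\<close>

definition prototile_data ::
  "(real ^ 'd::finite) set set \<Rightarrow> 'l::metric_space set \<Rightarrow> ('l \<Rightarrow> (real ^ 'd) set) \<Rightarrow> bool" where
  "prototile_data \<S> \<L> sp \<longleftrightarrow>
     (\<forall>S\<in>\<S>. S homeomorphic (cball 0 1 :: (real ^ 'd) set) \<and> 0 \<in> interior S) \<and>
     compact_space (Metric_space.mtopology \<S> hausdorff_dist) \<and>
     compact \<L> \<and>
     continuous_map (top_of_set \<L>) (Metric_space.mtopology \<S> hausdorff_dist) sp \<and>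
     sp ` \<L> = \<S>"

lemma prototile_data_Metric_space:
  fixes \<S> :: "(real ^ 'd::finite) set set"
  assumes "prototile_data \<S> \<L> sp"
  shows "Metric_space \<S> hausdorff_dist"
proof (rule Metric_space_hausdorff_dist)
  fix S assume "S \<in> \<S>"
  then have "S homeomorphic (cball 0 1 :: (real ^ 'd) set)" "0 \<in> interior S"
    using assms by (auto simp: prototile_data_def)
  then show "S \<noteq> {} \<and> compact S"
    using homeomorphic_compactness[of S "cball 0 1"] interior_subset[of S] by auto
qed

definition prototiles ::
  "(real ^ 'd) set set \<Rightarrow> 'l set \<Rightarrow> ('l \<Rightarrow> (real ^ 'd) set) \<Rightarrow> ('d::finite, 'l) tile set" where
  "prototiles \<S> \<L> sp = {(S, l). S \<in> \<S> \<and> l \<in> \<L> \<and> S = sp l}"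

abbreviation supp :: "('d, 'l) tile \<Rightarrow> (real ^ 'd) set" where "supp \<equiv> fst"
abbreviation label :: "('d, 'l) tile \<Rightarrow> 'l" where "label \<equiv> snd"

text \<open>\<open>translate_tile x t\<close> is the tile \<open>t - x\<close>, and \<open>translate_tiling x T\<close> is \<open>T - x\<close>.\<close>

definition translate_tile :: "real ^ 'd \<Rightarrow> ('d::finite, 'l) tile \<Rightarrow> ('d, 'l) tile" where
  "translate_tile x t = ((\<lambda>z. z - x) ` supp t, label t)"

definition translate_tiling ::
  "real ^ 'd \<Rightarrow> ('d::finite, 'l) tile set \<Rightarrow> ('d, 'l) tile set" where
  "translate_tiling x T = translate_tile x ` T"

definition tiles :: "('d::finite, 'l) tile set \<Rightarrow> ('d, 'l) tile set" where
  "tiles \<P> = {translate_tile x p | p x. p \<in> \<P>}"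

subsection \<open>Patches and tilings\<close>

text \<open>Patches and tilings are represented by their sets of tiles.\<close>

definition boundary_overlaps :: "('d::finite, 'l) tile set \<Rightarrow> bool" where
  "boundary_overlaps Q \<longleftrightarrow>
     (\<forall>t\<in>Q. \<forall>t'\<in>Q. t \<noteq> t' \<longrightarrow> supp t \<inter> supp t' \<subseteq> frontier (supp t) \<inter> frontier (supp t'))"

definition patch_supp :: "('d::finite, 'l) tile set \<Rightarrow> (real ^ 'd) set" where
  "patch_supp Q = (\<Union>t\<in>Q. supp t)"

definition is_patch :: "('d::finite, 'l) tile set \<Rightarrow> ('d, 'l) tile set \<Rightarrow> bool" where
  "is_patch \<P> Q \<longleftrightarrow>
     finite Q \<and> Q \<subseteq> tiles \<P> \<and> connected (patch_supp Q) \<and> boundary_overlaps Q"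

definition tilings :: "('d::finite, 'l) tile set \<Rightarrow> ('d, 'l) tile set set" where
  "tilings \<P> =
     {T. infinite T \<and> T \<subseteq> tiles \<P> \<and> patch_supp T = UNIV \<and> boundary_overlaps T}"

subsection \<open>Metrics\<close>

definition tile_dist ::
  "('d::finite, 'l::metric_space) tile \<Rightarrow> ('d, 'l) tile \<Rightarrow> real" where
  "tile_dist t1 t2 = max (hausdorff_dist (supp t1) (supp t2)) (dist (label t1) (label t2))"

text \<open>Only used for nonempty finite sets of tiles of the same cardinality; then the minimum is over
  a finite nonempty set of reals, although there are infinitely many functions \<open>g\<close> (they are
  unconstrained outside \<open>P1\<close>).\<close>

definition patch_dist ::
  "('d::finite, 'l::metric_space) tile set \<Rightarrow> ('d, 'l) tile set \<Rightarrow> real" where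
  "patch_dist P1 P2 = Min {Max ((\<lambda>t. tile_dist t (g t)) ` P1) | g. bij_betw g P1 P2}"

definition dist_witnesses ::
  "('d::finite, 'l::metric_space) tile set \<Rightarrow> ('d, 'l) tile set \<Rightarrow> ('d, 'l) tile set \<Rightarrow> real set" where
  "dist_witnesses \<P> T1 T2 =
     {\<epsilon>. \<epsilon> > 0 \<and> (\<exists>P1 P2. is_patch \<P> P1 \<and> P1 \<subseteq> T1 \<and> is_patch \<P> P2 \<and> P2 \<subseteq> T2 \<and>
        ball 0 (1 / \<epsilon>) \<subseteq> patch_supp P1 \<and> ball 0 (1 / \<epsilon>) \<subseteq> patch_supp P2 \<and>
        (\<exists>g. bij_betw g P1 P2) \<and> patch_dist P1 P2 < \<epsilon>)}"

definition tiling_dist ::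
  "('d::finite, 'l::metric_space) tile set \<Rightarrow> ('d, 'l) tile set \<Rightarrow> ('d, 'l) tile set \<Rightarrow> real" where
  "tiling_dist \<P> T1 T2 =
     (let E = dist_witnesses \<P> T1 T2 in if E = {} \<or> Inf E > 1 then 1 else Inf E)"

text \<open>The metric topology, written out instead of taking \<open>Metric_space.mtopology\<close>, whose facts
  presuppose the metric axioms for \<open>tiling_dist\<close>.\<close>

definition tiling_topology ::
  "('d::finite, 'l::metric_space) tile set \<Rightarrow> ('d, 'l) tile set topology" where
  "tiling_topology \<P> = topology (\<lambda>U. U \<subseteq> tilings \<P> \<and>
     (\<forall>T\<in>U. \<exists>r>0. {T' \<in> tilings \<P>. tiling_dist \<P> T T' < r} \<subseteq> U))"

lemma openin_tiling_topology:
  "openin (tiling_topology \<P>) U \<longleftrightarrow> U \<subseteq> tilings \<P> \<and>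
     (\<forall>T\<in>U. \<exists>r>0. {T' \<in> tilings \<P>. tiling_dist \<P> T T' < r} \<subseteq> U)"
proof -
  let ?O = "\<lambda>U. U \<subseteq> tilings \<P> \<and>
     (\<forall>T\<in>U. \<exists>r>0. {T' \<in> tilings \<P>. tiling_dist \<P> T T' < r} \<subseteq> U)"
  have inter: "?O (U \<inter> V)" if U: "?O U" and V: "?O V" for U V
  proof (intro conjI ballI)
    show "U \<inter> V \<subseteq> tilings \<P>" using U by blast
    fix T assume T: "T \<in> U \<inter> V"
    obtain r where r: "r > 0" "{T' \<in> tilings \<P>. tiling_dist \<P> T T' < r} \<subseteq> U"
      using U T by blast
    obtain s where s: "s > 0" "{T' \<in> tilings \<P>. tiling_dist \<P> T T' < s} \<subseteq> V"
      using V T by blast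
    show "\<exists>r>0. {T' \<in> tilings \<P>. tiling_dist \<P> T T' < r} \<subseteq> U \<inter> V"
    proof (intro exI conjI)
      show "0 < min r s" using r s by simp
      show "{T' \<in> tilings \<P>. tiling_dist \<P> T T' < min r s} \<subseteq> U \<inter> V"
        using r(2) s(2) by fastforce
    qed
  qed
  have union: "?O (\<Union>\<U>)" if U: "\<forall>K\<in>\<U>. ?O K" for \<U>
  proof (intro conjI ballI)
    show "\<Union>\<U> \<subseteq> tilings \<P>" using U by blast
    fix T assume "T \<in> \<Union>\<U>"
    then obtain K where K: "K \<in> \<U>" "T \<in> K" by blast
    then obtain r where "r > 0" "{T' \<in> tilings \<P>. tiling_dist \<P> T T' < r} \<subseteq> K"
      using U by blast
    then show "\<exists>r>0. {T' \<in> tilings \<P>. tiling_dist \<P> T T' < r} \<subseteq> \<Union>\<U>"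
      using K(1) by (meson Union_upper subset_trans)
  qed
  have "istopology ?O"
    unfolding istopology_def using inter union by simp
  then show ?thesis
    unfolding tiling_topology_def by (simp only: topology_inverse')
qed

lemma topspace_tiling_topology [simp]: "topspace (tiling_topology \<P>) = tilings \<P>"
proof (rule subset_antisym)
  have "openin (tiling_topology \<P>) (tilings \<P>)"
    unfolding openin_tiling_topology using zero_less_one by blast
  then show "tilings \<P> \<subseteq> topspace (tiling_topology \<P>)"
    by (rule openin_subset)
  show "topspace (tiling_topology \<P>) \<subseteq> tilings \<P>"
    using openin_topspace[of "tiling_topology \<P>"] unfolding openin_tiling_topology by (rule conjunct1)
qed

subsection \<open>Tiling spaces, fractures, eigenfunctions\<close>

definition tiling_space ::
  "('d::finite, 'l::metric_space) tile set \<Rightarrow> ('d, 'l) tile set set \<Rightarrow> bool" where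
  "tiling_space \<P> \<Omega> \<longleftrightarrow>
     \<Omega> \<subseteq> tilings \<P> \<and> (\<forall>T\<in>\<Omega>. \<forall>x. translate_tiling x T \<in> \<Omega>) \<and>
     closedin (tiling_topology \<P>) \<Omega>"

definition has_fracture ::
  "('d::finite, 'l::metric_space) tile set \<Rightarrow> ('d, 'l) tile set set \<Rightarrow> real ^ 'd \<Rightarrow> bool" where
  "has_fracture \<P> \<Omega> x \<longleftrightarrow> (\<exists>y. \<exists>T\<in>\<Omega>. \<exists>T'\<in>\<Omega>.
     ((\<lambda>t::real. tiling_dist \<P> (translate_tiling (t *\<^sub>R y) T)
                               (translate_tiling (t *\<^sub>R y) T')) \<longlongrightarrow> 0) at_top \<and>
     ((\<lambda>t::real. tiling_dist \<P> (translate_tiling (t *\<^sub>R y) T)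
                               (translate_tiling (t *\<^sub>R y) (translate_tiling x T'))) \<longlongrightarrow> 0) at_bot)"

definition eigenfunction ::
  "('d::finite, 'l) tile set set \<Rightarrow> (('d, 'l) tile set \<Rightarrow> complex) \<Rightarrow> real ^ 'd \<Rightarrow> bool" where
  "eigenfunction \<Omega> f \<alpha> \<longleftrightarrow> (\<forall>T\<in>\<Omega>. \<forall>y.
     f (translate_tiling y T) = exp (2 * of_real pi * \<i> * of_real (\<alpha> \<bullet> y)) * f T)"

end

theory Submission
  imports Defs
begin

text \<open>Along the direction \<open>y\<close> of the fracture, \<open>f (T - t y)\<close> and \<open>f (T' - t y)\<close> get arbitrarily close
  as \<open>t\<close> tends to infinity, by uniform continuity of \<open>f\<close> on the compact space \<open>\<Omega>\<close>; but the eigenvalue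
  equation shows that the modulus of their difference does not depend on \<open>t\<close>, so \<open>f T = f T'\<close>.
  The other end gives \<open>f T = f (T' - x) = exp (2 \<pi> i \<alpha> \<cdot> x) f T'\<close>, hence the exponential is 1.

  The supports need not have a uniform inradius or volume, so tilings are not known to be locally
  finite and \<open>tiling_dist\<close> is not known to be a metric. Uniform continuity is derived from a local
  substitute for the triangle inequality, in which the admissible \<open>\<delta>\<close> depends on the first point;
  a tiling that is not locally finite is an isolated point of the topology.\<close>

subsection \<open>Uniform continuity without the triangle inequality\<close>

text \<open>Finite subcover argument: each point of \<open>K\<close> gets an open set on which the
  bound \<open>e\<close> holds eventually along \<open>F\<close>. The hypotheses \<open>self\<close>
  and \<open>tri\<close> stand in for the metric axioms and suit distances that may be positive on
  the diagonal.\<close>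

lemma tendsto_diff_compactin:
  fixes d :: "'a \<Rightarrow> 'a \<Rightarrow> real" and f :: "'a \<Rightarrow> 'b::real_normed_vector"
  assumes openin_iff: "\<And>U. openin X U \<longleftrightarrow> U \<subseteq> M \<and> (\<forall>a\<in>U. \<exists>r>0. {b \<in> M. d a b < r} \<subseteq> U)"
    and self: "\<And>a b r. \<lbrakk>a \<in> M; b \<in> M; d a b < r\<rbrakk> \<Longrightarrow> d a a < r"
    and tri: "\<And>a r. \<lbrakk>a \<in> M; r > 0\<rbrakk> \<Longrightarrow>
      \<exists>\<delta>>0. \<forall>b\<in>M. \<forall>c\<in>M. d a b < \<delta> \<longrightarrow> d b c < \<delta> \<longrightarrow> d a c < r"
    and K: "compactin X K" "K \<subseteq> M"
    and f: "continuous_map (subtopology X K) euclidean f"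
    and uv: "\<And>t. u t \<in> K" "\<And>t. v t \<in> K"
    and lim: "((\<lambda>t. d (u t) (v t)) \<longlongrightarrow> 0) F"
  shows "((\<lambda>t. f (u t) - f (v t)) \<longlongrightarrow> 0) F"
proof (rule tendstoI)
  fix e :: real assume e: "e > 0"
  have ev: "\<forall>\<^sub>F t in F. d (u t) (v t) < r" if "r > 0" for r
    using order_tendstoD(2)[OF lim that] .
  have nbhd: "\<exists>V. openin X V \<and> p \<in> V \<and> (\<forall>\<^sub>F t in F. u t \<in> V \<longrightarrow> norm (f (u t) - f (v t)) < e)"
    if p: "p \<in> K" for p
  proof (cases "\<forall>r>0. d p p < r")
    case False
    then obtain r where r: "r > 0" "\<not> d p p < r" by blast
    \<comment> \<open>No point of \<open>M\<close>, not even \<open>p\<close>, lies within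
      \<open>r\<close> of \<open>p\<close>. So \<open>{p}\<close> is open, and
      \<open>u t = p\<close> is eventually impossible because \<open>d (u t) (v t)\<close> tends to
      0.\<close>
    have none: "\<not> d p b < r" if "b \<in> M" for b
      using self[of p b r] r p K that by blast
    have "openin X {p}"
      unfolding openin_iff using r(1) none p K(2) by blast
    moreover have "\<forall>\<^sub>F t in F. u t \<in> {p} \<longrightarrow> norm (f (u t) - f (v t)) < e"
      using ev[OF r(1)] by eventually_elim (use none uv K(2) in auto)
    ultimately show ?thesis by blast
  next
    case True
    have pM: "p \<in> M" using p K(2) by blast
    have "openin (subtopology X K) {b \<in> topspace (subtopology X K). f b \<in> ball (f p) (e/2)}"
      using f by (rule openin_continuous_map_preimage) (simp flip: open_openin)
    then obtain W where W: "openin X W"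
      "{b \<in> topspace (subtopology X K). f b \<in> ball (f p) (e/2)} = W \<inter> K"
      unfolding openin_subtopology by blast
    have top: "topspace (subtopology X K) = K"
      using compactin_subset_topspace[OF K(1)] by (simp add: Int_absorb1)
    have "p \<in> {b \<in> topspace (subtopology X K). f b \<in> ball (f p) (e/2)}"
      using p e unfolding top by simp
    then have "p \<in> W" unfolding W(2) by blast
    then obtain \<eta> where \<eta>: "\<eta> > 0" "{b \<in> M. d p b < \<eta>} \<subseteq> W"
      using W(1) unfolding openin_iff by blast
    have near: "dist (f p) (f b) < e/2" if "b \<in> K" "d p b < \<eta>" for b
    proof -
      have "b \<in> W \<inter> K" using \<eta>(2) that K(2) by blast
      then show ?thesis unfolding W(2)[symmetric] by simp
    qed
    obtain \<delta>' where \<delta>': "\<delta>' > 0"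
      "\<And>b c. \<lbrakk>b \<in> M; c \<in> M; d p b < \<delta>'; d b c < \<delta>'\<rbrakk> \<Longrightarrow> d p c < \<eta>"
      using tri[OF pM \<eta>(1)] by blast
    \<comment> \<open>The bound by \<open>\<delta>'\<close> will bring \<open>v t\<close> within
      \<open>\<eta>\<close> of \<open>p\<close>, the bound by \<open>\<eta>\<close> does so for
      \<open>u t\<close>.\<close>
    define \<delta> where "\<delta> = min \<delta>' \<eta>"
    have \<delta>: "\<delta> > 0" "\<delta> \<le> \<delta>'" "\<delta> \<le> \<eta>" using \<delta>'(1) \<eta>(1) by (auto simp: \<delta>_def)
    \<comment> \<open>Balls of \<open>d\<close> need not be open, so \<open>V\<close> is the
      interior of the \<open>\<delta>\<close>-ball about \<open>p\<close>. The condition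
      \<open>d p a < \<delta>\<close> is stated separately because \<open>a\<close> may lie outside
      its own small balls.\<close>
    define V where "V = {a \<in> M. d p a < \<delta> \<and> (\<exists>\<rho>>0. {b \<in> M. d a b < \<rho>} \<subseteq> {b \<in> M. d p b < \<delta>})}"
    have "openin X V"
      unfolding openin_iff
    proof (intro conjI ballI)
      show "V \<subseteq> M" by (auto simp: V_def)
      fix a assume "a \<in> V"
      then obtain \<rho> where a: "a \<in> M" "d p a < \<delta>"
        and \<rho>: "\<rho> > 0" "{b \<in> M. d a b < \<rho>} \<subseteq> {b \<in> M. d p b < \<delta>}"
        by (auto simp: V_def)
      \<comment> \<open>\<open>tri\<close> is used at \<open>a\<close>, so that one radius
        \<open>\<sigma>\<close> works for every \<open>b\<close> close to \<open>a\<close>.\<close>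
      obtain \<sigma> where \<sigma>: "\<sigma> > 0"
        "\<And>b c. \<lbrakk>b \<in> M; c \<in> M; d a b < \<sigma>; d b c < \<sigma>\<rbrakk> \<Longrightarrow> d a c < \<rho>"
        using tri[OF a(1) \<rho>(1)] by blast
      have "b \<in> V" if b: "b \<in> M" "d a b < min \<sigma> \<rho>" for b
      proof -
        have "{c \<in> M. d b c < \<sigma>} \<subseteq> {c \<in> M. d p c < \<delta>}"
          using \<sigma>(2)[of b] b \<rho>(2) by auto
        then show ?thesis using b \<rho>(2) \<sigma>(1) by (auto simp: V_def)
      qed
      then show "\<exists>r>0. {b \<in> M. d a b < r} \<subseteq> V"
        using \<sigma>(1) \<rho>(1) by (intro exI[of _ "min \<sigma> \<rho>"]) auto
    qed
    moreover have "p \<in> V" using True \<delta>(1) pM by (auto simp: V_def)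
    moreover have "\<forall>\<^sub>F t in F. u t \<in> V \<longrightarrow> norm (f (u t) - f (v t)) < e"
      using ev[OF \<delta>(1)]
    proof eventually_elim
      case (elim t)
      show ?case
      proof
        assume "u t \<in> V"
        then have u: "u t \<in> M" "d p (u t) < \<delta>" by (auto simp: V_def)
        have "d p (v t) < \<eta>"
          using \<delta>'(2)[of "u t" "v t"] u uv K(2) elim \<delta> by auto
        then have "dist (f p) (f (v t)) < e/2" "dist (f p) (f (u t)) < e/2"
          using near uv u \<delta> by auto
        then show "norm (f (u t) - f (v t)) < e"
          using dist_triangle_half_r[of "f p" "f (u t)" e "f (v t)"] by (simp add: dist_norm)
      qed
    qed
    ultimately show ?thesis by blast
  qed
  then obtain V where V: "\<And>p. p \<in> K \<Longrightarrow> openin X (V p) \<and> p \<in> V p \<and>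
      (\<forall>\<^sub>F t in F. u t \<in> V p \<longrightarrow> norm (f (u t) - f (v t)) < e)"
    by metis
  have "\<Union>(V ` K) \<supseteq> K" "\<And>U. U \<in> V ` K \<Longrightarrow> openin X U" using V by blast+
  then obtain \<F> where \<F>: "finite \<F>" "\<F> \<subseteq> V ` K" "K \<subseteq> \<Union>\<F>"
    using compactinD[OF K(1), of "V ` K"] by blast
  obtain C where C: "C \<subseteq> K" "finite C" "\<F> = V ` C"
    using finite_subset_image[OF \<F>(1,2)] by blast
  have "\<forall>\<^sub>F t in F. \<forall>p\<in>C. u t \<in> V p \<longrightarrow> norm (f (u t) - f (v t)) < e"
    using C(1) V by (intro eventually_ball_finite[OF C(2)]) blast
  then show "\<forall>\<^sub>F t in F. dist (f (u t) - f (v t)) 0 < e"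
  proof eventually_elim
    case (elim t)
    have "u t \<in> \<Union>(V ` C)" using \<F>(3) uv(1)[of t] unfolding C(3) by (rule subsetD)
    then obtain p where p: "p \<in> C" "u t \<in> V p" by (rule UN_E)
    show ?case using elim[rule_format, OF p] by simp
  qed
qed

subsection \<open>Tiles\<close>

text \<open>By invariance of domain the image of the open ball is open, hence inside the interior of
  \<open>S\<close>; continuity carries the closed ball, which is its closure, into the closure of
  that interior.\<close>

lemma homeomorphic_cball_subset_closure_interior:
  fixes S :: "'a::euclidean_space set"
  assumes "S homeomorphic (cball 0 1 :: 'a set)"
  shows "S \<subseteq> closure (interior S)"
proof -
  obtain h k where hk: "homeomorphism (cball 0 1 :: 'a set) S h k"
    using assms homeomorphic_sym unfolding homeomorphic_def by blast
  have cont: "continuous_on (cball 0 1) h" and img: "h ` cball 0 1 = S"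
    using hk by (simp_all add: homeomorphism_def)
  have inj: "inj_on h (cball 0 1)"
    using hk by (intro inj_on_inverseI[of _ k]) (simp add: homeomorphism_def)
  have "open (h ` ball 0 1)"
    using continuous_on_subset[OF cont ball_subset_cball] inj_on_subset[OF inj ball_subset_cball]
    by (rule invariance_of_domain[OF _ open_ball])
  then have sub: "h ` ball 0 1 \<subseteq> interior S"
    using img by (intro interior_maximal) auto
  have "h ` closure (ball 0 1) \<subseteq> closure (interior S)"
    using cont sub closure_subset by (intro image_closure_subset) auto
  then show ?thesis using img by simp
qed

lemma tiles_prototiles:
  fixes \<S> :: "(real ^ 'd::finite) set set"
  assumes "prototile_data \<S> \<L> sp" "t \<in> tiles (prototiles \<S> \<L> sp)"
  shows "compact (supp t)" "connected (supp t)" "supp t \<noteq> {}"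
    "supp t \<subseteq> closure (interior (supp t))"
proof -
  obtain S x where S: "S \<in> \<S>" and t: "supp t = (\<lambda>z. z - x) ` S"
    using assms(2) by (auto simp: tiles_def prototiles_def translate_tile_def)
  have h: "S homeomorphic (cball 0 1 :: (real ^ 'd) set)"
    using S assms(1) by (auto simp: prototile_data_def)
  have "S homeomorphic supp t"
    using homeomorphic_translation[of S "- x"] t by simp
  then have h': "supp t homeomorphic (cball 0 1 :: (real ^ 'd) set)"
    using h homeomorphic_sym homeomorphic_trans by blast
  show "compact (supp t)" "connected (supp t)" "supp t \<noteq> {}"
    using homeomorphic_compactness[OF h'] homeomorphic_connectedness[OF h']
      homeomorphic_empty h' by auto
  show "supp t \<subseteq> closure (interior (supp t))"
    by (rule homeomorphic_cball_subset_closure_interior[OF h'])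
qed

lemma hausdorff_dist_triangle:
  fixes A B C :: "'a::heine_borel set"
  assumes "A \<noteq> {}" "compact A" "B \<noteq> {}" "compact B" "C \<noteq> {}" "compact C"
  shows "hausdorff_dist A C \<le> hausdorff_dist A B + hausdorff_dist B C"
proof -
  \<comment> \<open>Only three sets are involved, so they serve as the carrier themselves.\<close>
  have "Metric_space {A, B, C} hausdorff_dist"
    using assms by (intro Metric_space_hausdorff_dist) blast
  then show ?thesis by (rule Metric_space.triangle) simp_all
qed

text \<open>A point of \<open>A\<close> in the ball has a nearest point in the compact set
  \<open>B\<close>, at distance less than \<open>\<epsilon>\<close>.\<close>

lemma hausdorff_dist_meets_ball:
  fixes A B :: "'a::heine_borel set"
  assumes "compact A" "compact B" "B \<noteq> {}" "hausdorff_dist A B < \<epsilon>"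
    and "A \<inter> ball x r \<noteq> {}"
  shows "B \<inter> ball x (r + \<epsilon>) \<noteq> {}"
proof -
  obtain a where a: "a \<in> A" "dist x a < r" using assms(5) by auto
  have "infdist a B \<le> hausdorff_dist A B"
    using hausdorff_dist_le_iff[of A B "hausdorff_dist A B"] a assms compact_imp_bounded by blast
  moreover obtain b where b: "b \<in> B" "infdist a B = dist a b"
    using infdist_attains_inf[OF compact_imp_closed] assms by metis
  ultimately have "dist x b < r + \<epsilon>"
    using dist_triangle[of x b a] a(2) assms(4) by linarith
  then show ?thesis using b(1) by auto
qed

subsection \<open>The tiling distance\<close>

text \<open>Makes different witnesses comparable: a patch taken from \<open>T\<close> that covers an
  open set \<open>C\<close> contains all these tiles, however it was chosen.\<close>

definition tiles_meeting ::
  "(real ^ 'd) set \<Rightarrow> ('d::finite, 'l) tile set \<Rightarrow> ('d, 'l) tile set" where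
  "tiles_meeting C T = {t \<in> T. supp t \<inter> C \<noteq> {}}"

text \<open>A tile is the closure of its interior, so a tile meeting an open set meets it in an interior
  point, which no other tile contains.\<close>

lemma tiles_meeting_subset_patch:
  fixes \<S> :: "(real ^ 'd::finite) set set"
  assumes pd: "prototile_data \<S> \<L> sp" and T: "T \<in> tilings (prototiles \<S> \<L> sp)"
    and Q: "Q \<subseteq> T" "C \<subseteq> patch_supp Q" and C: "open C"
  shows "tiles_meeting C T \<subseteq> Q"
proof
  fix t assume "t \<in> tiles_meeting C T"
  then obtain z where t: "t \<in> T" and z: "z \<in> supp t" "z \<in> C"
    by (auto simp: tiles_meeting_def)
  have "t \<in> tiles (prototiles \<S> \<L> sp)" using t T by (auto simp: tilings_def)
  then have "z \<in> closure (interior (supp t))"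
    using tiles_prototiles(4)[OF pd] z(1) by blast
  then have "C \<inter> interior (supp t) \<noteq> {}"
    using z(2) open_Int_closure_eq_empty[OF C] by blast
  then obtain w where w: "w \<in> C" "w \<in> interior (supp t)" by blast
  then obtain t' where t': "t' \<in> Q" "w \<in> supp t'"
    using Q(2) by (auto simp: patch_supp_def)
  have "w \<notin> frontier (supp t)" using w(2) by (simp add: frontier_def)
  then have "t' = t"
    using T t t' w(2) Q(1) interior_subset
    unfolding tilings_def boundary_overlaps_def by blast
  then show "t \<in> Q" using t' by simp
qed

lemma ball_subset_patch_supp_tiles_meeting:
  assumes "T \<in> tilings \<P>"
  shows "ball 0 r \<subseteq> patch_supp (tiles_meeting (ball 0 r) T)"
proof
  fix z :: "real ^ 'a" assume z: "z \<in> ball 0 r"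
  have "z \<in> patch_supp T" using assms by (simp add: tilings_def)
  then obtain t where "t \<in> T" "z \<in> supp t" unfolding patch_supp_def by blast
  then show "z \<in> patch_supp (tiles_meeting (ball 0 r) T)"
    using z unfolding patch_supp_def tiles_meeting_def by blast
qed

lemma is_patch_tiles_meeting:
  fixes \<S> :: "(real ^ 'd::finite) set set"
  assumes pd: "prototile_data \<S> \<L> sp" and T: "T \<in> tilings (prototiles \<S> \<L> sp)"
    and fin: "finite (tiles_meeting (ball 0 r) T)" and r: "r > 0"
  shows "is_patch (prototiles \<S> \<L> sp) (tiles_meeting (ball 0 r) T)"
proof -
  let ?Q = "tiles_meeting (ball 0 r) T"
  have Q: "?Q \<subseteq> T" by (auto simp: tiles_meeting_def)
  then have tiles: "?Q \<subseteq> tiles (prototiles \<S> \<L> sp)" using T by (auto simp: tilings_def)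
  have "?Q \<noteq> {}"
    using ball_subset_patch_supp_tiles_meeting[OF T, of r] r by (auto simp: patch_supp_def)
  \<comment> \<open>The ball is already covered, so adjoining it to every tile changes nothing; the
    enlarged connected pieces all share the origin.\<close>
  then have "patch_supp ?Q = (\<Union>t\<in>?Q. supp t \<union> ball 0 r)"
    using ball_subset_patch_supp_tiles_meeting[OF T, of r] by (auto simp: patch_supp_def)
  moreover have "connected (\<Union>t\<in>?Q. supp t \<union> ball 0 r)"
  proof (rule connected_Union)
    show "\<Inter>((\<lambda>t. supp t \<union> ball 0 r) ` ?Q) \<noteq> {}" using r centre_in_ball[of 0 r] by blast
    fix s assume "s \<in> (\<lambda>t. supp t \<union> ball 0 r) ` ?Q"
    then show "connected s"
      using tiles tiles_prototiles(2)[OF pd]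
      by (auto simp: tiles_meeting_def intro!: connected_Un)
  qed
  ultimately have "connected (patch_supp ?Q)" by simp
  moreover have "boundary_overlaps ?Q"
    using Q T unfolding tilings_def boundary_overlaps_def by blast
  ultimately show ?thesis
    using fin tiles by (simp add: is_patch_def)
qed

lemma tile_dist_meets_ball:
  assumes pd: "prototile_data \<S> \<L> sp"
    and "t \<in> tiles (prototiles \<S> \<L> sp)" "t' \<in> tiles (prototiles \<S> \<L> sp)"
    and "tile_dist t t' < \<epsilon>"
  shows "supp t \<inter> ball 0 r \<noteq> {} \<Longrightarrow> supp t' \<inter> ball 0 (r + \<epsilon>) \<noteq> {}"
    and "supp t' \<inter> ball 0 r \<noteq> {} \<Longrightarrow> supp t \<inter> ball 0 (r + \<epsilon>) \<noteq> {}"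
proof -
  note t = tiles_prototiles(1,3)[OF pd assms(2)] and t' = tiles_prototiles(1,3)[OF pd assms(3)]
  have d: "hausdorff_dist (supp t) (supp t') < \<epsilon>" using assms(4) by (simp add: tile_dist_def)
  show "supp t \<inter> ball 0 r \<noteq> {} \<Longrightarrow> supp t' \<inter> ball 0 (r + \<epsilon>) \<noteq> {}"
    by (rule hausdorff_dist_meets_ball[OF t(1) t' d])
  have "hausdorff_dist (supp t') (supp t) < \<epsilon>" using d by (simp add: hausdorff_dist_commute)
  then show "supp t' \<inter> ball 0 r \<noteq> {} \<Longrightarrow> supp t \<inter> ball 0 (r + \<epsilon>) \<noteq> {}"
    by (rule hausdorff_dist_meets_ball[OF t'(1) t])
qed

lemma tile_dist_triangle:
  assumes pd: "prototile_data \<S> \<L> sp"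
    and "a \<in> tiles (prototiles \<S> \<L> sp)" "b \<in> tiles (prototiles \<S> \<L> sp)"
      "c \<in> tiles (prototiles \<S> \<L> sp)"
  shows "tile_dist a c \<le> tile_dist a b + tile_dist b c"
proof -
  have "hausdorff_dist (supp a) (supp c)
      \<le> hausdorff_dist (supp a) (supp b) + hausdorff_dist (supp b) (supp c)"
    using tiles_prototiles[OF pd] assms(2-4) by (intro hausdorff_dist_triangle) blast+
  moreover have "dist (label a) (label c) \<le> dist (label a) (label b) + dist (label b) (label c)"
    by (rule dist_triangle)
  ultimately show ?thesis unfolding tile_dist_def by linarith
qed

section \<open>Witnesses for small patch and tiling distances\<close>

text \<open>Each maximum is over a subset of the finitely many distances between tiles of
  \<open>P1\<close> and \<open>P2\<close>, so only finitely many maxima occur and the minimum is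
  attained by some bijection.\<close>

lemma patch_dist_less_iff:
  assumes "finite P1" "P1 \<noteq> {}" "bij_betw g P1 P2"
  shows "patch_dist P1 P2 < \<epsilon> \<longleftrightarrow> (\<exists>g. bij_betw g P1 P2 \<and> (\<forall>t\<in>P1. tile_dist t (g t) < \<epsilon>))"
proof -
  let ?M = "{Max ((\<lambda>t. tile_dist t (g t)) ` P1) | g. bij_betw g P1 P2}"
  have "finite P2" using assms bij_betw_finite by blast
  have "?M \<subseteq> Max ` Pow ((\<lambda>(t, t'). tile_dist t t') ` (P1 \<times> P2))"
    by (auto simp: bij_betw_def intro!: imageI)
  then have "finite ?M"
    by (rule finite_subset) (use \<open>finite P1\<close> \<open>finite P2\<close> in auto)
  moreover have "?M \<noteq> {}" using assms(3) by blast
  ultimately have "patch_dist P1 P2 < \<epsilon> \<longleftrightarrow> (\<exists>m\<in>?M. m < \<epsilon>)"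
    unfolding patch_dist_def by (rule Min_less_iff)
  also have "\<dots> \<longleftrightarrow> (\<exists>g. bij_betw g P1 P2 \<and> Max ((\<lambda>t. tile_dist t (g t)) ` P1) < \<epsilon>)"
    by blast
  also have "\<dots> \<longleftrightarrow> (\<exists>g. bij_betw g P1 P2 \<and> (\<forall>t\<in>P1. tile_dist t (g t) < \<epsilon>))"
    using assms(1,2) by simp
  finally show ?thesis .
qed

lemma dist_witnesses_iff:
  "\<epsilon> \<in> dist_witnesses \<P> T1 T2 \<longleftrightarrow> \<epsilon> > 0 \<and> (\<exists>P1 P2 g. is_patch \<P> P1 \<and> P1 \<subseteq> T1 \<and>
     is_patch \<P> P2 \<and> P2 \<subseteq> T2 \<and> ball 0 (1 / \<epsilon>) \<subseteq> patch_supp P1 \<and>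
     ball 0 (1 / \<epsilon>) \<subseteq> patch_supp P2 \<and> bij_betw g P1 P2 \<and> (\<forall>t\<in>P1. tile_dist t (g t) < \<epsilon>))"
proof -
  have *: "(\<exists>g. bij_betw g P1 P2) \<and> patch_dist P1 P2 < \<epsilon> \<longleftrightarrow>
      (\<exists>g. bij_betw g P1 P2 \<and> (\<forall>t\<in>P1. tile_dist t (g t) < \<epsilon>))"
    if "\<epsilon> > 0" "is_patch \<P> P1" "ball 0 (1 / \<epsilon>) \<subseteq> patch_supp P1" for P1 P2 :: "('a, 'b) tile set"
  proof -
    have "finite P1" using that(2) by (simp add: is_patch_def)
    \<comment> \<open>A patch covering the origin is nonempty, which gives \<open>Max\<close> its
      meaning.\<close>
    moreover have "0 \<in> ball (0 :: real ^ 'a) (1 / \<epsilon>)" using that(1) by simp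
    then have "P1 \<noteq> {}" using that(3) by (auto simp: patch_supp_def)
    ultimately show ?thesis using patch_dist_less_iff by blast
  qed
  show ?thesis
    unfolding dist_witnesses_def mem_Collect_eq
    by (intro conj_cong refl ex_cong1) (use * in auto)
qed

text \<open>The value 1, used both as cap and as default, is never below \<open>r \<le> 1\<close>,
  so the inequality can only come from the infimum of actual witnesses.\<close>

lemma tiling_dist_less_iff:
  assumes "r \<le> 1"
  shows "tiling_dist \<P> A B < r \<longleftrightarrow> (\<exists>\<epsilon>\<in>dist_witnesses \<P> A B. \<epsilon> < r)"
proof -
  let ?E = "dist_witnesses \<P> A B"
  have "bdd_below ?E"
    by (rule bdd_belowI[of _ 0]) (auto simp: dist_witnesses_def)
  then have "?E \<noteq> {} \<Longrightarrow> Inf ?E < r \<longleftrightarrow> (\<exists>\<epsilon>\<in>?E. \<epsilon> < r)"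
    by (simp add: cInf_less_iff)
  moreover have "tiling_dist \<P> A B < r \<longleftrightarrow> ?E \<noteq> {} \<and> Inf ?E < r"
    using assms by (simp add: tiling_dist_def Let_def)
  ultimately show ?thesis by blast
qed

lemma tiling_dist_le_1: "tiling_dist \<P> A B \<le> 1"
  by (simp add: tiling_dist_def Let_def)

text \<open>The first patch of a witness for \<open>A\<close> and \<open>B\<close>, matched with
  itself by the identity, is a witness for \<open>A\<close> and \<open>A\<close>. This supplies the
  hypothesis \<open>self\<close> of \<open>tendsto_diff_compactin\<close>.\<close>

lemma tiling_dist_self_less:
  fixes \<S> :: "(real ^ 'd::finite) set set" and A B :: "('d, 'l::metric_space) tile set"
  assumes pd: "prototile_data \<S> \<L> sp"
    and "tiling_dist (prototiles \<S> \<L> sp) A B < r"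
  shows "tiling_dist (prototiles \<S> \<L> sp) A A < r"
proof (cases "r \<le> 1")
  case True
  then obtain \<epsilon> where \<epsilon>: "\<epsilon> \<in> dist_witnesses (prototiles \<S> \<L> sp) A B" "\<epsilon> < r"
    using assms(2) tiling_dist_less_iff by blast
  have zero: "tile_dist t t = 0" if "t \<in> tiles (prototiles \<S> \<L> sp)" for t
  proof -
    have "hausdorff_dist (supp t) (supp t) \<le> 0"
      using tiles_prototiles[OF pd that] hausdorff_dist_le_iff[of "supp t" "supp t" 0]
      by (simp add: compact_imp_bounded)
    then show ?thesis by (simp add: tile_dist_def antisym hausdorff_dist_nonneg)
  qed
  obtain P where P: "\<epsilon> > 0" "is_patch (prototiles \<S> \<L> sp) P" "P \<subseteq> A"
    "ball 0 (1 / \<epsilon>) \<subseteq> patch_supp P"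
    using \<epsilon>(1) unfolding dist_witnesses_iff by blast
  moreover have "\<forall>t\<in>P. tile_dist t (id t) < \<epsilon>"
    using zero P(1,2) by (auto simp: is_patch_def)
  ultimately have "\<epsilon> \<in> dist_witnesses (prototiles \<S> \<L> sp) A A"
    unfolding dist_witnesses_iff using bij_betw_id by blast
  then show ?thesis using \<epsilon>(2) tiling_dist_less_iff[OF True] by blast
next
  case False
  then show ?thesis using tiling_dist_le_1[of _ A A] by (meson le_less_trans not_le)
qed

section \<open>The local triangle inequality\<close>

text \<open>The finitely many tiles meeting the large ball have finitely many distances from the
  origin, so there is a gap in these distances just above \<open>R\<close>.\<close>

lemma tiles_meeting_gap:
  fixes \<S> :: "(real ^ 'd::finite) set set"
  assumes pd: "prototile_data \<S> \<L> sp" and T: "T \<in> tilings (prototiles \<S> \<L> sp)"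
    and fin: "finite (tiles_meeting (ball 0 (R + 1)) T)"
  obtains r \<gamma> where "R < r" "\<gamma> > 0" "r + \<gamma> \<le> R + 1"
    "tiles_meeting (ball 0 (r + \<gamma>)) T = tiles_meeting (ball 0 r) T"
proof -
  define D where "D = {t \<in> tiles_meeting (ball 0 (R + 1)) T. infdist 0 (supp t) > R}"
  have "finite D" using fin by (simp add: D_def)
  \<comment> \<open>Upper end of the gap. Inserting \<open>R + 1\<close> handles an empty
    \<open>D\<close> and keeps the gap inside the ball where finiteness is known.\<close>
  define m where "m = Min (insert (R + 1) ((\<lambda>t. infdist 0 (supp t)) ` D))"
  have m: "R < m" "m \<le> R + 1" "\<And>t. t \<in> D \<Longrightarrow> m \<le> infdist 0 (supp t)"
    using \<open>finite D\<close> by (auto simp: m_def D_def)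
  have meets: "supp t \<inter> ball 0 s \<noteq> {} \<longleftrightarrow> infdist 0 (supp t) < s" if "t \<in> T" for t s
  proof -
    have t: "t \<in> tiles (prototiles \<S> \<L> sp)" using that T by (auto simp: tilings_def)
    obtain z where z: "z \<in> supp t" "infdist 0 (supp t) = dist 0 z"
      using infdist_attains_inf[OF compact_imp_closed] tiles_prototiles[OF pd t] by metis
    have "infdist 0 (supp t) \<le> dist 0 w" if "w \<in> supp t" for w by (rule infdist_le[OF that])
    then show ?thesis using z by (force simp: set_eq_iff)
  qed
  show thesis
  \<comment> \<open>The radius is the midpoint of the gap and \<open>\<gamma>\<close> half its
    length, so \<open>r + \<gamma> = m\<close>.\<close>
  proof (rule that[of "(R + m) / 2" "(m - R) / 2"])
    have "(R + m) / 2 + (m - R) / 2 = m" by (simp add: field_simps)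
    moreover have "infdist 0 (supp t) < (R + m) / 2" if "t \<in> T" "infdist 0 (supp t) < m" for t
    proof (rule ccontr)
      assume "\<not> infdist 0 (supp t) < (R + m) / 2"
      then have "infdist 0 (supp t) > R" using m(1) by (simp add: field_simps)
      then have "t \<in> D" using that m(2) meets[of t "R + 1"] by (auto simp: D_def tiles_meeting_def)
      then show False using m(3) that(2) by fastforce
    qed
    moreover have "(R + m) / 2 < m" using m(1) by simp
    ultimately have "infdist 0 (supp t) < (R + m) / 2 + (m - R) / 2 \<longleftrightarrow>
        infdist 0 (supp t) < (R + m) / 2" if "t \<in> T" for t
      using that less_trans by metis
    then show "tiles_meeting (ball 0 ((R + m) / 2 + (m - R) / 2)) T
        = tiles_meeting (ball 0 ((R + m) / 2)) T"
      unfolding tiles_meeting_def using meets by blast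
  qed (use m in \<open>auto simp: field_simps\<close>)
qed

text \<open>The matching tiles must form connected patches, although matched tiles may touch in one
  tiling and not in the other. By local finiteness there is a radius near which no tile of \<open>A\<close>
  begins to meet the ball; for \<open>\<delta>\<close> below this gap, the tiles of \<open>C\<close> matched to those of \<open>A\<close>
  that meet the ball are again exactly the tiles meeting some ball.\<close>

lemma tiling_dist_local_triangle:
  fixes \<S> :: "(real ^ 'd::finite) set set" and A :: "('d, 'l::metric_space) tile set"
  assumes pd: "prototile_data \<S> \<L> sp" and A: "A \<in> tilings (prototiles \<S> \<L> sp)" and "\<eta> > 0"
  shows "\<exists>\<delta>>0. \<forall>B\<in>tilings (prototiles \<S> \<L> sp). \<forall>C\<in>tilings (prototiles \<S> \<L> sp).
    tiling_dist (prototiles \<S> \<L> sp) A B < \<delta> \<longrightarrow> tiling_dist (prototiles \<S> \<L> sp) B C < \<delta> \<longrightarrow>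
    tiling_dist (prototiles \<S> \<L> sp) A C < \<eta>"
proof -
  let ?P = "prototiles \<S> \<L> sp"
  \<comment> \<open>This will be the witness for \<open>A\<close> and \<open>C\<close>, strictly
    below both \<open>\<eta>\<close> and 1.\<close>
  define \<epsilon> where "\<epsilon> = min \<eta> 1 / 2"
  define R where "R = 1 / \<epsilon>"
  have \<epsilon>: "\<epsilon> > 0" "\<epsilon> \<le> 1" "\<epsilon> < \<eta>" "\<epsilon> < 1" using \<open>\<eta> > 0\<close> by (auto simp: \<epsilon>_def)
  have R: "R > 0" using \<epsilon> by (simp add: R_def)
  show ?thesis
  proof (cases "finite (tiles_meeting (ball 0 (R + 1)) A)")
    case False
    \<comment> \<open>A witness below \<open>1 / (R + 1)\<close> would put the infinitely many tiles
      meeting the ball into a finite patch. Hence no tiling is that close to \<open>A\<close>, and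
      the claim holds vacuously.\<close>
    have "\<not> tiling_dist ?P A B < 1 / (R + 1)" for B
    proof
      assume "tiling_dist ?P A B < 1 / (R + 1)"
      then obtain e where e: "e \<in> dist_witnesses ?P A B" "e < 1 / (R + 1)"
        using tiling_dist_less_iff[of "1 / (R + 1)" ?P A B] R by auto
      then obtain P where P: "e > 0" "is_patch ?P P" "P \<subseteq> A" "ball 0 (1 / e) \<subseteq> patch_supp P"
        unfolding dist_witnesses_iff by blast
      have "R + 1 \<le> 1 / e" using e(2) P(1) R by (simp add: field_simps)
      then have "ball 0 (R + 1) \<subseteq> patch_supp P" using P(4) subset_ball by blast
      then have "tiles_meeting (ball 0 (R + 1)) A \<subseteq> P"
        using tiles_meeting_subset_patch[OF pd A P(3)] by simp
      then show False using False P(2) finite_subset by (auto simp: is_patch_def)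
    qed
    moreover have "1 / (R + 1) > 0" using R by simp
    ultimately show ?thesis by blast
  next
    case True
    obtain r \<gamma> where r: "R < r" "\<gamma> > 0" "r + \<gamma> \<le> R + 1"
      "tiles_meeting (ball 0 (r + \<gamma>)) A = tiles_meeting (ball 0 r) A"
      by (rule tiles_meeting_gap[OF pd A True])
    \<comment> \<open>The bounds serve, in order: \<open>tiling_dist_less_iff\<close>; the passage
      from \<open>A\<close> to \<open>C\<close> and back, which enlarges the radius by
      \<open>4 * \<delta>\<close>; the sum of two tile distances; and coverage of the ball of radius
      \<open>R + 1\<close>.\<close>
    define \<delta> where "\<delta> = min (min 1 (\<gamma> / 4)) (min (\<epsilon> / 2) (1 / (R + 1)))"
    have \<delta>: "\<delta> > 0" "\<delta> \<le> 1" "4 * \<delta> \<le> \<gamma>" "2 * \<delta> \<le> \<epsilon>" "\<delta> \<le> 1 / (R + 1)"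
      using r(2) \<epsilon>(1) R by (simp_all add: \<delta>_def)
    have "tiling_dist ?P A C < \<eta>"
      if B: "B \<in> tilings ?P" and C: "C \<in> tilings ?P"
        and AB: "tiling_dist ?P A B < \<delta>" and BC: "tiling_dist ?P B C < \<delta>" for B C
    proof -
      obtain e where e: "e \<in> dist_witnesses ?P A B" "e < \<delta>"
        using AB tiling_dist_less_iff[OF \<delta>(2)] by blast
      obtain e' where e': "e' \<in> dist_witnesses ?P B C" "e' < \<delta>"
        using BC tiling_dist_less_iff[OF \<delta>(2)] by blast
      have radius: "R + 1 \<le> 1 / x" if "0 < x" "x < \<delta>" for x
      proof -
        have "x \<le> 1 / (R + 1)" using \<delta>(5) that by linarith
        then show ?thesis using that R by (simp add: field_simps)
      qed
      have cover: "tiles_meeting (ball 0 s) T \<subseteq> P"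
        if "T \<in> tilings ?P" "P \<subseteq> T" "ball 0 (1 / x) \<subseteq> patch_supp P" "0 < x" "x < \<delta>" "s \<le> R + 1"
        for s T P x
      proof -
        have "ball 0 s \<subseteq> ball 0 (1 / x)" using radius[of x] that by (intro subset_ball) simp
        then show ?thesis
          using tiles_meeting_subset_patch[OF pd that(1,2)] that(3) by blast
      qed
      obtain P1 P2 g where g: "e > 0" "is_patch ?P P1" "P1 \<subseteq> A" "P2 \<subseteq> B"
        "ball 0 (1 / e) \<subseteq> patch_supp P1" "ball 0 (1 / e) \<subseteq> patch_supp P2"
        "bij_betw g P1 P2" "\<forall>t\<in>P1. tile_dist t (g t) < e"
        using e(1) unfolding dist_witnesses_iff by blast
      obtain P3 P4 h where h: "e' > 0" "P3 \<subseteq> B" "P4 \<subseteq> C"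
        "ball 0 (1 / e') \<subseteq> patch_supp P3" "ball 0 (1 / e') \<subseteq> patch_supp P4"
        "bij_betw h P3 P4" "\<forall>t\<in>P3. tile_dist t (h t) < e'"
        using e'(1) unfolding dist_witnesses_iff by blast
      have tile: "t \<in> tiles ?P" if "t \<in> A \<or> t \<in> B \<or> t \<in> C" for t
        using that A B C by (auto simp: tilings_def)
      have gd: "tile_dist t (g t) < \<delta>" "g t \<in> P2" "t \<in> tiles ?P" "g t \<in> tiles ?P"
        if "t \<in> P1" for t
        using that g(3,4,7,8) e(2) tile bij_betwE[OF g(7)] by fastforce+
      have hd: "tile_dist t (h t) < \<delta>" "h t \<in> P4" "t \<in> tiles ?P" "h t \<in> tiles ?P"
        if "t \<in> P3" for t
        using that h(2,3,6,7) e'(2) tile bij_betwE[OF h(6)] by fastforce+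
      \<comment> \<open>Each of the two matchings \<open>g\<close> and \<open>h\<close> costs at
        most \<open>\<delta>\<close> in the radius.\<close>
      let ?Q = "tiles_meeting (ball 0 r) A" and ?Q' = "tiles_meeting (ball 0 (r + 2 * \<delta>)) C"
      have QP: "?Q \<subseteq> P1"
        using cover[OF A g(3,5,1) e(2)] r by simp
      \<comment> \<open>The two witnesses use unrelated patches \<open>P2\<close> and
        \<open>P3\<close> of \<open>B\<close>; this inclusion makes \<open>h\<close> a matching on
        the images under \<open>g\<close>.\<close>
      have gQ: "g ` ?Q \<subseteq> P3"
      proof
        fix b assume "b \<in> g ` ?Q"
        then obtain t where t: "b = g t" "t \<in> P1" "supp t \<inter> ball 0 r \<noteq> {}"
          using QP by (auto simp: tiles_meeting_def)
        then have "supp b \<inter> ball 0 (r + \<delta>) \<noteq> {}"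
          using tile_dist_meets_ball(1)[OF pd] gd[of t] by blast
        then have "b \<in> tiles_meeting (ball 0 (r + \<delta>)) B"
          using t g(4) gd[of t] by (auto simp: tiles_meeting_def)
        then show "b \<in> P3" using cover[OF B h(2,4,1) e'(2), of "r + \<delta>"] \<delta> r by auto
      qed
      have img: "(h \<circ> g) ` ?Q = ?Q'"
      proof (intro subset_antisym subsetI)
        fix c assume "c \<in> (h \<circ> g) ` ?Q"
        then obtain t where Q: "t \<in> ?Q" and c: "c = h (g t)" by auto
        then have t: "c = h (g t)" "t \<in> P1" "g t \<in> P3" "supp t \<inter> ball 0 r \<noteq> {}"
          using QP gQ by (blast, blast, blast, simp add: tiles_meeting_def)
        have "supp (g t) \<inter> ball 0 (r + \<delta>) \<noteq> {}"
          using tile_dist_meets_ball(1)[OF pd] gd[OF t(2)] t(4) by blast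
        then have "supp c \<inter> ball 0 (r + \<delta> + \<delta>) \<noteq> {}"
          using tile_dist_meets_ball(1)[OF pd] hd[OF t(3)] t(1) by blast
        then have "supp c \<inter> ball 0 (r + 2 * \<delta>) \<noteq> {}" by (simp add: add.assoc)
        then show "c \<in> ?Q'" using hd[OF t(3)] h(3) t(1) by (auto simp: tiles_meeting_def)
      next
        fix c assume c: "c \<in> ?Q'"
        then have "c \<in> P4" using cover[OF C h(3,5,1) e'(2), of "r + 2 * \<delta>"] \<delta> r by auto
        then obtain b where b: "b \<in> P3" "c = h b" using h(6) by (auto simp: bij_betw_def)
        have "supp c \<inter> ball 0 (r + 2 * \<delta>) \<noteq> {}" using c by (simp add: tiles_meeting_def)
        then have bm: "supp b \<inter> ball 0 (r + 2 * \<delta> + \<delta>) \<noteq> {}"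
          using tile_dist_meets_ball(2)[OF pd] hd[OF b(1)] b(2) by blast
        then have "b \<in> tiles_meeting (ball 0 (r + 2 * \<delta> + \<delta>)) B"
          using b(1) h(2) by (auto simp: tiles_meeting_def)
        then have "b \<in> P2" using cover[OF B g(4,6,1) e(2), of "r + 2 * \<delta> + \<delta>"] \<delta> r by auto
        then obtain a where a: "a \<in> P1" "b = g a" using g(7) by (auto simp: bij_betw_def)
        have "supp a \<inter> ball 0 (r + 2 * \<delta> + \<delta> + \<delta>) \<noteq> {}"
          using tile_dist_meets_ball(2)[OF pd] gd[OF a(1)] a(2) bm by blast
        \<comment> \<open>Pulling \<open>c\<close> back to \<open>A\<close> only gives a tile
          meeting the ball of radius \<open>r + 4 * \<delta>\<close>; the gap puts it back into
          \<open>?Q\<close>.\<close>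
        moreover have "ball 0 (r + 2 * \<delta> + \<delta> + \<delta>) \<subseteq> ball (0 :: real ^ 'd) (r + \<gamma>)"
          using \<delta>(3) by (intro subset_ball) simp
        ultimately have "a \<in> tiles_meeting (ball 0 (r + \<gamma>)) A"
          using a(1) g(3) unfolding tiles_meeting_def by blast
        then show "c \<in> (h \<circ> g) ` ?Q" using r(4) a(2) b(2) by auto
      qed
      have "inj_on g ?Q" using g(7) QP by (auto simp: bij_betw_def intro: inj_on_subset)
      moreover have "inj_on h (g ` ?Q)"
        using h(6) gQ by (auto simp: bij_betw_def intro: inj_on_subset)
      ultimately have bij: "bij_betw (h \<circ> g) ?Q ?Q'"
        using img by (auto simp: bij_betw_def intro: comp_inj_on)
      have fin: "finite ?Q" using QP g(2) finite_subset by (auto simp: is_patch_def)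
      \<comment> \<open>Finiteness on the side of \<open>C\<close> is inherited through the
        bijection.\<close>
      then have fin': "finite ?Q'" using bij bij_betw_finite by blast
      have close: "\<forall>t\<in>?Q. tile_dist t ((h \<circ> g) t) < \<epsilon>"
      proof
        fix t assume "t \<in> ?Q"
        then have t: "t \<in> P1" "g t \<in> P3" using QP gQ by auto
        show "tile_dist t ((h \<circ> g) t) < \<epsilon>"
          using tile_dist_triangle[OF pd gd(3)[OF t(1)] gd(4)[OF t(1)] hd(4)[OF t(2)]]
            gd(1)[OF t(1)] hd(1)[OF t(2)] \<delta>(4) by simp
      qed
      have balls: "ball 0 (1 / \<epsilon>) \<subseteq> patch_supp ?Q" "ball 0 (1 / \<epsilon>) \<subseteq> patch_supp ?Q'"
        using ball_subset_patch_supp_tiles_meeting[OF A, of r] r(1) \<delta>(1)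
          ball_subset_patch_supp_tiles_meeting[OF C, of "r + 2 * \<delta>"]
          subset_ball[of "1 / \<epsilon>" r 0] subset_ball[of "1 / \<epsilon>" "r + 2 * \<delta>" 0]
        unfolding R_def by auto
      have "is_patch ?P ?Q" "is_patch ?P ?Q'"
        using is_patch_tiles_meeting[OF pd A fin] is_patch_tiles_meeting[OF pd C fin'] r(1) R \<delta>(1)
        by auto
      moreover have "?Q \<subseteq> A" "?Q' \<subseteq> C" by (auto simp: tiles_meeting_def)
      ultimately have "\<epsilon> \<in> dist_witnesses ?P A C"
        unfolding dist_witnesses_iff using bij close balls \<epsilon>(1) by blast
      then have "tiling_dist ?P A C < min \<eta> 1"
        using tiling_dist_less_iff[of "min \<eta> 1" ?P A C] \<epsilon> by auto
      then show ?thesis by simp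
    qed
    then show ?thesis using \<delta>(1) by blast
  qed
qed

subsection \<open>Eigenfunctions and fractures\<close>

text \<open>Treats one end of a fracture; the filter \<open>F\<close> is left general to serve both
  \<open>at_top\<close> and \<open>at_bot\<close>.\<close>

lemma tendsto_eigenfunction_diff:
  fixes \<S> :: "(real ^ 'd::finite) set set" and \<Omega> :: "('d, 'l::metric_space) tile set set"
  assumes "prototile_data \<S> \<L> sp"
    and "tiling_space (prototiles \<S> \<L> sp) \<Omega>"
    and "compactin (tiling_topology (prototiles \<S> \<L> sp)) \<Omega>"
    and "continuous_map (subtopology (tiling_topology (prototiles \<S> \<L> sp)) \<Omega>) euclidean f"
    and ef: "eigenfunction \<Omega> f \<alpha>" and TT': "T \<in> \<Omega>" "T' \<in> \<Omega>" and F: "F \<noteq> bot"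
    and "((\<lambda>t::real. tiling_dist (prototiles \<S> \<L> sp) (translate_tiling (t *\<^sub>R y) T)
           (translate_tiling (t *\<^sub>R y) T')) \<longlongrightarrow> 0) F"
  shows "f T = f T'"
proof -
  have \<Omega>: "\<Omega> \<subseteq> tilings (prototiles \<S> \<L> sp)" "\<And>S z. S \<in> \<Omega> \<Longrightarrow> translate_tiling z S \<in> \<Omega>"
    using assms(2) by (auto simp: tiling_space_def)
  have "((\<lambda>t. f (translate_tiling (t *\<^sub>R y) T) - f (translate_tiling (t *\<^sub>R y) T')) \<longlongrightarrow> 0) F"
    by (rule tendsto_diff_compactin[OF openin_tiling_topology
          tiling_dist_self_less[OF assms(1)] tiling_dist_local_triangle[OF assms(1)]
          assms(3) \<Omega>(1) assms(4) \<Omega>(2)[OF TT'(1)] \<Omega>(2)[OF TT'(2)] assms(9)])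
  moreover have "norm (f (translate_tiling z T) - f (translate_tiling z T')) = norm (f T - f T')" for z
  proof -
    \<comment> \<open>Both values acquire the same factor, of modulus 1 because
      \<open>\<alpha> \<bullet> z\<close> is real.\<close>
    have "f (translate_tiling z T) - f (translate_tiling z T')
        = exp (\<i> * of_real (2 * pi * (\<alpha> \<bullet> z))) * (f T - f T')"
      using ef TT' by (simp add: eigenfunction_def algebra_simps)
    then show ?thesis by (simp only: norm_mult norm_exp_i_times mult_1)
  qed
  ultimately have "((\<lambda>t. norm (f T - f T')) \<longlongrightarrow> 0) F"
    by (auto dest: tendsto_norm_zero)
  \<comment> \<open>A constant can tend to 0 along a nontrivial filter only if it is 0.\<close>
  then have "norm (f T - f T') = 0" by (simp only: tendsto_const_iff[OF F])
  then show ?thesis by simp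
qed

theorem theorem5p5:
  fixes \<S> :: "(real ^ 'd::finite) set set"
    and \<L> :: "'l::metric_space set"
    and sp :: "'l \<Rightarrow> (real ^ 'd) set"
    and \<Omega> :: "('d, 'l) tile set set"
    and f :: "('d, 'l) tile set \<Rightarrow> complex"
    and \<alpha> x :: "real ^ 'd"
  assumes "prototile_data \<S> \<L> sp"
    and "tiling_space (prototiles \<S> \<L> sp) \<Omega>"
    and "compactin (tiling_topology (prototiles \<S> \<L> sp)) \<Omega>"
    and "continuous_map (subtopology (tiling_topology (prototiles \<S> \<L> sp)) \<Omega>) euclidean f"
    and "eigenfunction \<Omega> f \<alpha>"
    and "\<forall>T\<in>\<Omega>. f T \<noteq> 0"
    and "has_fracture (prototiles \<S> \<L> sp) \<Omega> x"
  shows "\<alpha> \<bullet> x \<in> \<int>"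
proof -
  let ?P = "prototiles \<S> \<L> sp"
  obtain y T T' where T: "T \<in> \<Omega>" "T' \<in> \<Omega>"
    and plus: "((\<lambda>t::real. tiling_dist ?P (translate_tiling (t *\<^sub>R y) T)
      (translate_tiling (t *\<^sub>R y) T')) \<longlongrightarrow> 0) at_top"
    and minus: "((\<lambda>t::real. tiling_dist ?P (translate_tiling (t *\<^sub>R y) T)
      (translate_tiling (t *\<^sub>R y) (translate_tiling x T'))) \<longlongrightarrow> 0) at_bot"
    using assms(7) unfolding has_fracture_def by blast
  have x: "translate_tiling x T' \<in> \<Omega>"
    using assms(2) T(2) by (auto simp: tiling_space_def)
  have "f T = f T'"
    by (rule tendsto_eigenfunction_diff[OF assms(1-5) T _ plus]) simp
  moreover have "f T = f (translate_tiling x T')"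
    by (rule tendsto_eigenfunction_diff[OF assms(1-5) T(1) x _ minus]) simp
  moreover have "f (translate_tiling x T') = exp (2 * of_real pi * \<i> * of_real (\<alpha> \<bullet> x)) * f T'"
    using assms(5) T(2) by (auto simp: eigenfunction_def)
  \<comment> \<open>Comparing the two expressions for \<open>f T\<close> gives \<open>f T'\<close>
    as the exponential times itself; it is nonzero and cancels.\<close>
  ultimately have "exp (2 * of_real pi * \<i> * of_real (\<alpha> \<bullet> x)) = (1 :: complex)"
    using assms(6) T(2) by simp
  then obtain n :: int where "2 * pi * (\<alpha> \<bullet> x) = of_int (2 * n) * pi"
    by (auto simp: exp_eq_1)
  then have "\<alpha> \<bullet> x = of_int n" by simp
  then show ?thesis by simp
qed

end
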